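(* For every integer $x$, there exists a nonempty finite set $A_x \subseteq \mathbb{Z}$ such that $\Delta(A_x) = -x$, i.e. $|A_x \dotplus A_x| - |A_x - A_x| = x$.
   Context: For a nonempty finite set $A \subseteq \mathbb{Z}$, define $A - A := \{a - b : a, b \in A\}$, the restricted sumset $A \dotplus A := \{a + b : a, b \in A,\ a \neq b\}$, and $\Delta(A) := |A - A| - |A \dotplus A|$. *)

theory Defs
  imports Main
begin

(* Not the set-theoretic difference "A - A" of HOL, which is always empty. *)
definition difference_set :: "int set \<Rightarrow> int set" where
  "difference_set A = {a - b | a b. a \<in> A \<and> b \<in> A}"

definition restricted_sumset :: "int set \<Rightarrow> int set" where
  "restricted_sumset A = {a + b | a b. a \<in> A \<and> b \<in> A \<and> a \<noteq> b}"

(* Integer-valued, since the difference of cardinalities may be negative. *)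
definition Delta :: "int set \<Rightarrow> int" where
  "Delta A = int (card (difference_set A)) - int (card (restricted_sumset A))"

end

theory Submission
  imports Defs
begin

text \<open>
  Let \<open>A\<close> be a subset of \<open>[0, n]\<close> that looks like \<open>L\<close> near \<open>0\<close>, like \<open>n - R\<close> near \<open>n\<close>, and is full
  in between. The restricted sums missing from \<open>[0, 2n]\<close> come from the gaps of the restricted
  sumsets of \<open>L\<close> and of \<open>R\<close>, one for one, whereas each gap of \<open>L + R\<close> costs two differences
  \<open>\<plusminus>d\<close> in \<open>[-n, n]\<close>. Modulo 7, the residues \<open>{0, 1, 3}\<close> have a sumset missing only the class 5,
  those of \<open>{0, 1, 2, 4}\<close> have a full sumset, and the sum of the two sets misses only the class 6.
  Prolonging this pattern over \<open>k\<close> periods therefore changes \<open>Delta\<close> by \<open>k - 2k = -k\<close>. Large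
  values come from \<open>L = {0} \<union> [k, \<infinity>)\<close> and \<open>R = [0, \<infinity>)\<close>.
\<close>

section \<open>Intervals with prescribed fringes, and gap sets\<close>

definition fringed_interval :: "int \<Rightarrow> int set \<Rightarrow> int set \<Rightarrow> int set" where
  "fringed_interval n L R = {a \<in> {0..n}. a \<in> L \<and> n - a \<in> R}"

definition sum_gaps :: "int set \<Rightarrow> int set \<Rightarrow> int set" where
  "sum_gaps L R = {0..} - {a + b | a b. a \<in> L \<and> b \<in> R}"

definition restricted_gaps :: "int set \<Rightarrow> int set" where
  "restricted_gaps L = {0..} - restricted_sumset L"

lemma fringed_interval_reflect:
  "fringed_interval n R L = (\<lambda>a. n - a) ` fringed_interval n L R"
proof -
  have "x \<in> (\<lambda>a. n - a) ` fringed_interval n L R" if "x \<in> fringed_interval n R L" for x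
    using that by (intro image_eqI[of _ _ "n - x"]) (auto simp: fringed_interval_def)
  then show ?thesis
    by (auto simp: fringed_interval_def)
qed

text \<open>Lets sums above \<open>n\<close> be treated as sums below \<open>n\<close> of the
  reflected set, in which \<open>L\<close> and \<open>R\<close> have changed places.\<close>

lemma restricted_sumset_reflect:
  "s \<in> restricted_sumset ((\<lambda>a. n - a) ` A) \<longleftrightarrow> 2 * n - s \<in> restricted_sumset A"
proof
  assume "s \<in> restricted_sumset ((\<lambda>a. n - a) ` A)"
  then show "2 * n - s \<in> restricted_sumset A"
    unfolding restricted_sumset_def by fastforce
next
  assume "2 * n - s \<in> restricted_sumset A"
  then obtain a b where "a \<in> A" "b \<in> A" "a \<noteq> b" "2 * n - s = a + b"
    unfolding restricted_sumset_def by blast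
  then have "n - a \<in> (\<lambda>a. n - a) ` A \<and> n - b \<in> (\<lambda>a. n - a) ` A \<and> n - a \<noteq> n - b
      \<and> s = (n - a) + (n - b)"
    by auto
  then show "s \<in> restricted_sumset ((\<lambda>a. n - a) ` A)"
    unfolding restricted_sumset_def by blast
qed

section \<open>Counting sums and differences for general fringes\<close>

locale fringes =
  fixes L R :: "int set" and N :: int
  assumes L_nonneg: "L \<subseteq> {0..}" and R_nonneg: "R \<subseteq> {0..}"
    and L_zero: "0 \<in> L" and R_zero: "0 \<in> R"
    and N_pos: "0 < N" and L_tail: "{N..} \<subseteq> L" and R_tail: "{N..} \<subseteq> R"
begin

lemma swap: "fringes R L N"
  using L_nonneg R_nonneg L_zero R_zero N_pos L_tail R_tail by unfold_locales

lemma restricted_gaps_subset: "restricted_gaps L \<subseteq> {0..<N}"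
proof
  fix s assume s: "s \<in> restricted_gaps L"
  have "s \<in> restricted_sumset L" if "N \<le> s"
    unfolding restricted_sumset_def using that L_zero L_tail N_pos
    by (intro CollectI exI[of _ 0] exI[of _ s]) auto
  then show "s \<in> {0..<N}"
    using s unfolding restricted_gaps_def by force
qed

lemma sum_gaps_subset: "sum_gaps L R \<subseteq> {0..<N}"
proof
  fix s assume s: "s \<in> sum_gaps L R"
  have "\<exists>a b. s = a + b \<and> a \<in> L \<and> b \<in> R" if "N \<le> s"
    using that L_zero R_tail by (intro exI[of _ 0] exI[of _ s]) auto
  then show "s \<in> {0..<N}"
    using s unfolding sum_gaps_def by force
qed

text \<open>The choice \<open>n = 4 * N\<close> keeps the two fringes apart, with a full block from
  \<open>N\<close> to \<open>3 * N\<close> between them.\<close>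

context
  fixes n :: int and A :: "int set"
  assumes n_def: "n = 4 * N" and A_def: "A = fringed_interval n L R"
begin

lemma middle_subset: "{N..n - N} \<subseteq> A"
  using L_tail R_tail N_pos unfolding A_def fringed_interval_def by auto

text \<open>Here \<open>n - a\<close> is at least \<open>N\<close>, so the condition on
  \<open>R\<close> holds by \<open>R_tail\<close> and \<open>L\<close> alone decides.\<close>

lemma mem_low: "a \<le> n - N \<Longrightarrow> a \<in> A \<longleftrightarrow> a \<in> L"
  using L_nonneg R_tail N_pos unfolding A_def fringed_interval_def by auto

lemma mem_high: "b \<le> n - N \<Longrightarrow> n - b \<in> A \<longleftrightarrow> b \<in> R"
  using R_nonneg L_tail N_pos unfolding A_def fringed_interval_def by auto

lemma A_bounds: "a \<in> A \<Longrightarrow> 0 \<le> a \<and> a \<le> n"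
  unfolding A_def fringed_interval_def by auto

lemma restricted_sumset_low:
  assumes "0 \<le> s" "s \<le> n"
  shows "s \<in> restricted_sumset A \<longleftrightarrow> s \<notin> restricted_gaps L"
proof (cases "s \<le> n - N")
  case True
  have "s \<in> restricted_sumset A \<longleftrightarrow> s \<in> restricted_sumset L"
  proof
    assume "s \<in> restricted_sumset A"
    then obtain a b where ab: "a \<in> A" "b \<in> A" "a \<noteq> b" "s = a + b"
      unfolding restricted_sumset_def by blast
    with True have "a \<in> L" "b \<in> L"
      using A_bounds[of a] A_bounds[of b] mem_low by auto
    then show "s \<in> restricted_sumset L"
      using ab unfolding restricted_sumset_def by blast
  next
    assume "s \<in> restricted_sumset L"
    then obtain a b where ab: "a \<in> L" "b \<in> L" "a \<noteq> b" "s = a + b"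
      unfolding restricted_sumset_def by blast
    with True have "0 \<le> a" "0 \<le> b" "a \<le> n - N" "b \<le> n - N"
      using L_nonneg by force+
    then have "a \<in> A" "b \<in> A"
      using ab mem_low by auto
    then show "s \<in> restricted_sumset A"
      using ab unfolding restricted_sumset_def by blast
  qed
  then show ?thesis
    using assms by (simp add: restricted_gaps_def)
next
  case False
  have "s \<notin> restricted_gaps L"
    using restricted_gaps_subset False n_def N_pos by fastforce
  \<comment> \<open>As \<open>s\<close> exceeds \<open>3 * N\<close>, the numbers \<open>N\<close>
    and \<open>s - N\<close> are distinct elements of the full block.\<close>
  moreover have "N \<in> A" "s - N \<in> A"
    using middle_subset False assms n_def N_pos by auto
  then have "s \<in> restricted_sumset A"
    unfolding restricted_sumset_def using False n_def N_pos
    by (intro CollectI exI[of _ N] exI[of _ "s - N"]) auto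
  ultimately show ?thesis
    by blast
qed

text \<open>The equation \<open>n - t = x - y\<close> reads \<open>t = y + (n - x)\<close>, where
  \<open>y\<close> lies in \<open>L\<close> and \<open>n - x\<close> in \<open>R\<close>.
  Differences close to \<open>n\<close> are thus governed by small sums of the two fringes.\<close>

lemma difference_set_nonneg:
  assumes "0 \<le> t" "t \<le> n"
  shows "n - t \<in> difference_set A \<longleftrightarrow> t \<notin> sum_gaps L R"
proof (cases "t \<le> n - N")
  case True
  have "n - t \<in> difference_set A \<longleftrightarrow> (\<exists>a b. t = a + b \<and> a \<in> L \<and> b \<in> R)"
  proof
    assume "n - t \<in> difference_set A"
    then obtain x y where xy: "x \<in> A" "y \<in> A" "n - t = x - y"
      unfolding difference_set_def by blast
    then have "y \<in> L" "n - x \<in> R"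
      unfolding A_def fringed_interval_def by auto
    then show "\<exists>a b. t = a + b \<and> a \<in> L \<and> b \<in> R"
      using xy by (intro exI[of _ y] exI[of _ "n - x"]) auto
  next
    assume "\<exists>a b. t = a + b \<and> a \<in> L \<and> b \<in> R"
    then obtain a b where ab: "t = a + b" "a \<in> L" "b \<in> R"
      by blast
    then have "0 \<le> a" "0 \<le> b"
      using L_nonneg R_nonneg by auto
    then have "a \<in> A" "n - b \<in> A"
      using ab True mem_low[of a] mem_high[of b] by auto
    then show "n - t \<in> difference_set A"
      unfolding difference_set_def using ab
      by (intro CollectI exI[of _ "n - b"] exI[of _ a]) auto
  qed
  then show ?thesis
    using assms by (auto simp: sum_gaps_def)
next
  case False
  have "t \<notin> sum_gaps L R"
    using sum_gaps_subset False n_def N_pos by fastforce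
  \<comment> \<open>The difference \<open>n - t\<close> is now below \<open>N\<close> and occurs
    inside the full block.\<close>
  moreover have "N + (n - t) \<in> A" "N \<in> A"
    using middle_subset False assms n_def N_pos by auto
  then have "n - t \<in> difference_set A"
    unfolding difference_set_def
    by (intro CollectI exI[of _ "N + (n - t)"] exI[of _ N]) auto
  ultimately show ?thesis
    by blast
qed

lemma difference_set_eq:
  "difference_set A
    = {-n..n} - ((\<lambda>t. n - t) ` sum_gaps L R \<union> (\<lambda>t. t - n) ` sum_gaps L R)" (is "?S = ?T")
proof -
  have bound: "- n \<le> d \<and> d \<le> n" if d: "d \<in> difference_set A" for d
  proof -
    obtain a b where "a \<in> A" "b \<in> A" "d = a - b"
      using d unfolding difference_set_def by blast
    then show ?thesis
      using A_bounds[of a] A_bounds[of b] by simp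
  qed
  have minus: "- d \<in> difference_set A \<longleftrightarrow> d \<in> difference_set A" for d
  proof -
    have "- d \<in> difference_set A" if "d \<in> difference_set A" for d
      using that unfolding difference_set_def by force
    from this[of d] this[of "- d"] show ?thesis
      by auto
  qed
  have key: "d \<in> difference_set A \<longleftrightarrow> n - d \<notin> sum_gaps L R \<and> n + d \<notin> sum_gaps L R"
    if d: "-n \<le> d" "d \<le> n" for d
  proof (cases "0 \<le> d")
    case True
    \<comment> \<open>All gaps lie below \<open>N\<close>, so for each sign of \<open>d\<close> only
      one of the two conditions can fail.\<close>
    then have "n + d \<notin> sum_gaps L R"
      using sum_gaps_subset n_def N_pos by fastforce
    then show ?thesis
      using difference_set_nonneg[of "n - d"] True d by simp
  next
    case False
    then have "n - d \<notin> sum_gaps L R"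
      using sum_gaps_subset n_def N_pos by fastforce
    then show ?thesis
      using difference_set_nonneg[of "n + d"] False d minus[of d] by simp
  qed
  have img: "d \<in> (\<lambda>t. n - t) ` sum_gaps L R \<longleftrightarrow> n - d \<in> sum_gaps L R"
    "d \<in> (\<lambda>t. t - n) ` sum_gaps L R \<longleftrightarrow> n + d \<in> sum_gaps L R" for d
    by (force simp: image_iff)+
  show ?thesis
  proof (rule set_eqI)
    fix d
    show "d \<in> ?S \<longleftrightarrow> d \<in> ?T"
      unfolding Diff_iff Un_iff img atLeastAtMost_iff using key[of d] bound[of d] by argo
  qed
qed

text \<open>The two copies of the gap set lie near \<open>n\<close> and near \<open>-n\<close>,
  hence are disjoint, which gives the factor 2.\<close>

lemma card_difference_set:
  "int (card (difference_set A)) = 2 * n + 1 - 2 * int (card (sum_gaps L R))"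
proof -
  let ?M = "sum_gaps L R"
  let ?P = "(\<lambda>t. n - t) ` ?M" and ?Q = "(\<lambda>t. t - n) ` ?M"
  have fin: "finite ?M"
    using sum_gaps_subset finite_subset by blast
  have "?P \<subseteq> {n - N<..n}" "?Q \<subseteq> {-n..<N - n}"
    using sum_gaps_subset by fastforce+
  moreover have "{n - N<..n} \<inter> {-n..<N - n} = {}"
    "{n - N<..n} \<union> {-n..<N - n} \<subseteq> {-n..n}"
    using n_def N_pos by auto
  ultimately have sub: "?P \<union> ?Q \<subseteq> {-n..n}" and disj: "?P \<inter> ?Q = {}"
    by blast+
  have "card (?P \<union> ?Q) = card ?M + card ?M"
    using fin disj by (simp add: card_Un_disjoint card_image inj_on_def)
  moreover have "card (?P \<union> ?Q) \<le> card {-n..n}"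
    using sub by (intro card_mono) auto
  moreover have "card (difference_set A) = card {-n..n} - card (?P \<union> ?Q)"
    unfolding difference_set_eq using sub fin by (intro card_Diff_subset) auto
  ultimately show ?thesis
    using n_def N_pos by simp
qed

end

text \<open>Placed after the inner context, where \<open>A\<close> is no longer fixed: the upper
  half applies \<open>restricted_sumset_low\<close> to the reflected set, with \<open>L\<close> and
  \<open>R\<close> exchanged.\<close>

lemma restricted_sumset_eq:
  assumes n_def: "n = 4 * N" and A_def: "A = fringed_interval n L R"
  shows "restricted_sumset A
    = {0..2 * n} - (restricted_gaps L \<union> (\<lambda>s. 2 * n - s) ` restricted_gaps R)" (is "?S = ?T")
proof -
  have bound: "0 \<le> s \<and> s \<le> 2 * n" if "s \<in> restricted_sumset A" for s
    using that unfolding restricted_sumset_def A_def fringed_interval_def by auto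
  have key: "s \<in> restricted_sumset A \<longleftrightarrow> s \<notin> restricted_gaps L \<and> 2 * n - s \<notin> restricted_gaps R"
    if s: "0 \<le> s" "s \<le> 2 * n" for s
  proof (cases "s \<le> n")
    case True
    then have "2 * n - s \<notin> restricted_gaps R"
      using fringes.restricted_gaps_subset[OF swap] n_def N_pos by fastforce
    then show ?thesis
      using restricted_sumset_low[OF assms, of s] True s by simp
  next
    case False
    then have "s \<notin> restricted_gaps L"
      using restricted_gaps_subset n_def N_pos by fastforce
    moreover have "2 * n - s \<in> restricted_sumset (fringed_interval n R L)
        \<longleftrightarrow> s \<in> restricted_sumset A"
      unfolding A_def fringed_interval_reflect[of n R L] restricted_sumset_reflect by simp
    ultimately show ?thesis
      using fringes.restricted_sumset_low[OF swap n_def refl, of "2 * n - s"] False s by simp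
  qed
  have img: "s \<in> (\<lambda>s. 2 * n - s) ` restricted_gaps R \<longleftrightarrow> 2 * n - s \<in> restricted_gaps R" for s
    by (force simp: image_iff)
  show ?thesis
  proof (rule set_eqI)
    fix s
    show "s \<in> ?S \<longleftrightarrow> s \<in> ?T"
      unfolding Diff_iff Un_iff img atLeastAtMost_iff using key[of s] bound[of s] by argo
  qed
qed

lemma card_restricted_sumset:
  assumes n_def: "n = 4 * N" and A_def: "A = fringed_interval n L R"
  shows "int (card (restricted_sumset A))
    = 2 * n + 1 - int (card (restricted_gaps L)) - int (card (restricted_gaps R))"
proof -
  let ?P = "restricted_gaps L" and ?Q = "(\<lambda>s. 2 * n - s) ` restricted_gaps R"
  note subs = restricted_gaps_subset fringes.restricted_gaps_subset[OF swap]
  have fin: "finite (restricted_gaps L)" "finite (restricted_gaps R)"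
    using subs finite_subset by blast+
  have sub: "?P \<union> ?Q \<subseteq> {0..2 * n}" and disj: "?P \<inter> ?Q = {}"
    using subs n_def N_pos by fastforce+
  have "card (?P \<union> ?Q) = card (restricted_gaps L) + card (restricted_gaps R)"
    using fin disj by (simp add: card_Un_disjoint card_image inj_on_def)
  moreover have "card (?P \<union> ?Q) \<le> card {0..2 * n}"
    using sub by (intro card_mono) auto
  moreover have "card (restricted_sumset A) = card {0..2 * n} - card (?P \<union> ?Q)"
    unfolding restricted_sumset_eq[OF assms] using sub fin by (intro card_Diff_subset) auto
  ultimately show ?thesis
    using n_def N_pos by simp
qed

text \<open>Both counts start from \<open>2 * n + 1\<close>, which cancels. What remains is to
  choose fringes with suitable gap counts.\<close>

lemma Delta_attained:
  "\<exists>A. finite A \<and> A \<noteq> {} \<and> Delta A = int (card (restricted_gaps L))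
    + int (card (restricted_gaps R)) - 2 * int (card (sum_gaps L R))"
proof (intro exI conjI)
  let ?A = "fringed_interval (4 * N) L R"
  show "finite ?A"
    unfolding fringed_interval_def by (rule finite_subset[of _ "{0..4 * N}"]) auto
  show "?A \<noteq> {}"
    using middle_subset[OF refl refl] N_pos by auto
  show "Delta ?A = int (card (restricted_gaps L))
      + int (card (restricted_gaps R)) - 2 * int (card (sum_gaps L R))"
    unfolding Delta_def card_difference_set[OF refl refl] card_restricted_sumset[OF refl refl]
    by simp
qed

end

section \<open>Gap criteria, and the values from 2 upwards\<close>

lemma restricted_sumsetI:
  "a \<in> A \<Longrightarrow> s - a \<in> A \<Longrightarrow> s \<noteq> 2 * a \<Longrightarrow> s \<in> restricted_sumset A"
  unfolding restricted_sumset_def by (intro CollectI exI[of _ a] exI[of _ "s - a"]) auto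

lemma mem_sum_gaps_iff:
  "s \<in> sum_gaps L R \<longleftrightarrow> 0 \<le> s \<and> (\<forall>a\<in>L. s - a \<notin> R)"
  unfolding sum_gaps_def by (auto; metis add_diff_cancel_left' diff_add_cancel add.commute)

lemma mem_restricted_gaps_iff:
  "s \<in> restricted_gaps L \<longleftrightarrow> 0 \<le> s \<and> (\<forall>a\<in>L. s - a \<in> L \<longrightarrow> s = 2 * a)"
proof -
  have "s \<in> restricted_sumset L \<longleftrightarrow> (\<exists>a\<in>L. s - a \<in> L \<and> s \<noteq> 2 * a)"
    using restricted_sumsetI[of _ L s] unfolding restricted_sumset_def by force
  then show ?thesis
    unfolding restricted_gaps_def by auto
qed

lemma Delta_large:
  assumes "2 \<le> (x::int)"
  shows "\<exists>A. finite A \<and> A \<noteq> {} \<and> Delta A = x"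
proof -
  \<comment> \<open>The fringe \<open>L\<close> has \<open>k\<close> gaps, \<open>{0..}\<close> has
    the single gap 0 (only \<open>0 + 0\<close>), and the mixed sum has none, so the value is
    \<open>k + 1\<close>.\<close>
  define k where "k = x - 1"
  have k: "1 \<le> k"
    using assms k_def by simp
  define L where "L = insert 0 {k..}"
  have "fringes L {0..} k"
    using k unfolding L_def by unfold_locales auto
  moreover have "restricted_gaps L = {0..<k}"
    using k unfolding L_def by (auto simp: mem_restricted_gaps_iff)
  moreover have "restricted_gaps {0..} = {0}"
  proof -
    have "s = 0" if "\<forall>a\<in>{0..}. s - a \<in> {0..} \<longrightarrow> s = 2 * a" "0 \<le> s" for s :: int
      using that by force
    then show ?thesis
      by (auto simp: mem_restricted_gaps_iff)
  qed
  moreover have "sum_gaps L {0..} = {}"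
    unfolding L_def by (auto simp: mem_sum_gaps_iff)
  ultimately show ?thesis
    using fringes.Delta_attained[of L "{0..}" k] k k_def by simp
qed

section \<open>Fringes periodic modulo 7, and the values up to 3\<close>

definition mod7_fringe :: "int set \<Rightarrow> int \<Rightarrow> int set" where
  "mod7_fringe X k = {a. 0 \<le> a \<and> (a < 7 * k \<longrightarrow> a mod 7 \<in> X)}"

lemma card_arithmetic_progression:
  "card ((\<lambda>i. 7 * i + c) ` {0..<k}) = nat k" for c k :: int
  by (subst card_image) (auto simp: inj_on_def)

lemma mem_arithmetic_progression_iff:
  fixes s k c :: int
  assumes "0 \<le> c" "c < 7"
  shows "s \<in> (\<lambda>i. 7 * i + c) ` {0..<k} \<longleftrightarrow> 0 \<le> s \<and> s < 7 * k \<and> s mod 7 = c"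
proof
  assume "0 \<le> s \<and> s < 7 * k \<and> s mod 7 = c"
  then show "s \<in> (\<lambda>i. 7 * i + c) ` {0..<k}"
    by (intro image_eqI[of _ _ "s div 7"]) auto
qed (use assms in auto)

lemma mod7_diff: "(s - a) mod 7 = (s mod 7 - a mod 7) mod (7::int)"
  by (simp add: mod_diff_eq)

lemma mod7_cases:
  "s mod 7 = 0 \<or> s mod 7 = 1 \<or> s mod 7 = 2 \<or> s mod 7 = 3 \<or> s mod 7 = 4 \<or> s mod 7 = 5
    \<or> s mod 7 = (6::int)"
  by presburger

text \<open>The six sums of two elements of \<open>{0, 1, 3}\<close>, repetition allowed, are
  distinct modulo 7 and miss only 5. The numbers 0, 2, 6 arise only as doubles of 0, 1, 3;
  everything else is reached with one summand 0, 1 or 3.\<close>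

lemma restricted_gaps_mod7_013:
  assumes "1 \<le> k"
  shows "restricted_gaps (mod7_fringe {0, 1, 3} k)
    = {0, 2, 6} \<union> (\<lambda>i. 7 * i + 5) ` {0..<k}" (is "restricted_gaps ?L = _")
proof (intro set_eqI iffI)
  fix s assume "s \<in> restricted_gaps ?L"
  then have s: "0 \<le> s" and gap: "\<And>a. a \<in> ?L \<Longrightarrow> s - a \<in> ?L \<Longrightarrow> s = 2 * a"
    by (auto simp: mem_restricted_gaps_iff)
  have "0 \<in> ?L" "1 \<in> ?L" "3 \<in> ?L"
    by (auto simp: mod7_fringe_def)
  with gap have * : "s - 0 \<in> ?L \<Longrightarrow> s = 0" "s - 1 \<in> ?L \<Longrightarrow> s = 2" "s - 3 \<in> ?L \<Longrightarrow> s = 6"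
    by fastforce+
  have out: "x mod 7 \<notin> {0, 1, 3} \<and> x < 7 * k" if "0 \<le> x" "x \<notin> ?L" for x
    using that by (auto simp: mod7_fringe_def)
  have "s mod 7 = 5 \<and> s < 7 * k" if "s \<noteq> 0" "s \<noteq> 2" "s \<noteq> 6"
  proof -
    have "s \<notin> ?L"
      using *(1) that(1) by (metis diff_zero)
    from out[OF s this] have r: "s mod 7 \<notin> {0, 1, 3}" "s < 7 * k"
      by simp_all
    then have "s \<noteq> 1"
      by auto
    then have "(s - 1) mod 7 \<notin> {0, 1, 3}"
      using *(2) out[of "s - 1"] s that(1,2) by linarith
    then have r': "s mod 7 \<notin> {2, 4}"
      using mod7_diff[of s 1] by auto
    then have "3 \<le> s"
      using \<open>s \<noteq> 1\<close> s that by simp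
    then have "(s - 3) mod 7 \<notin> {0, 1, 3}"
      using *(3) out[of "s - 3"] that(3) by linarith
    then have "s mod 7 \<noteq> 6"
      using mod7_diff[of s 3] by auto
    then show ?thesis
      using r r' mod7_cases[of s] by simp
  qed
  then show "s \<in> {0, 2, 6} \<union> (\<lambda>i. 7 * i + 5) ` {0..<k}"
    using s mem_arithmetic_progression_iff[of 5 s k] by auto
next
  fix s assume "s \<in> {0, 2, 6} \<union> (\<lambda>i. 7 * i + 5) ` {0..<k}"
  \<comment> \<open>The hypothesis on \<open>k\<close> puts 0, 2 and 6 below \<open>7 * k\<close>,
    so that residues constrain both summands.\<close>
  then have s: "0 \<le> s" "s < 7 * k" "s = 0 \<or> s = 2 \<or> s = 6 \<or> s mod 7 = 5"
    using assms mem_arithmetic_progression_iff[of 5 s k] by auto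
  have "s = 2 * a" if "a \<in> ?L" "s - a \<in> ?L" for a
  proof -
    have a: "0 \<le> a" "a \<le> s" "a mod 7 \<in> {0, 1, 3}" "(s - a) mod 7 \<in> {0, 1, 3}"
      using that s(2) by (auto simp: mod7_fringe_def)
    then have "s mod 7 \<noteq> 5"
      using mod7_diff[of s a] by auto
    then have "a \<in> {0..6}" "s = 0 \<or> s = 2 \<or> s = 6"
      using s(3) a by auto
    then show ?thesis
      using a by auto
  qed
  then show "s \<in> restricted_gaps ?L"
    using s by (auto simp: mem_restricted_gaps_iff)
qed

text \<open>Summand 0 reaches the positive elements of the fringe, including the doubles 2 and 4;
  summand 1 reaches the classes 3 and 5, summand 2 the class 6.\<close>

lemma restricted_gaps_mod7_0124:
  "restricted_gaps (mod7_fringe {0, 1, 2, 4} k) = {0}" (is "restricted_gaps ?R = _")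
proof (intro set_eqI iffI)
  fix s assume "s \<in> restricted_gaps ?R"
  then have s: "0 \<le> s" and gap: "\<And>a. a \<in> ?R \<Longrightarrow> s - a \<in> ?R \<Longrightarrow> s = 2 * a"
    by (auto simp: mem_restricted_gaps_iff)
  have "0 \<in> ?R" "1 \<in> ?R" "2 \<in> ?R"
    by (auto simp: mod7_fringe_def)
  with gap have * : "s - 0 \<in> ?R \<Longrightarrow> s = 0" "s - 1 \<in> ?R \<Longrightarrow> s = 2" "s - 2 \<in> ?R \<Longrightarrow> s = 4"
    by fastforce+
  have out: "x mod 7 \<notin> {0, 1, 2, 4}" if "0 \<le> x" "x \<notin> ?R" for x
    using that by (auto simp: mod7_fringe_def)
  have False if "s \<noteq> 0"
  proof -
    have "s \<notin> ?R"
      using *(1) that by (metis diff_zero)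
    from out[OF s this] have r: "s mod 7 \<notin> {0, 1, 2, 4}" .
    then have "s \<noteq> 1" "s \<noteq> 2" "s \<noteq> 4"
      by auto
    then have "(s - 1) mod 7 \<notin> {0, 1, 2, 4}" "(s - 2) mod 7 \<notin> {0, 1, 2, 4}"
      using *(2,3) out[of "s - 1"] out[of "s - 2"] s that by linarith+
    then show False
      using r mod7_diff[of s 1] mod7_diff[of s 2] mod7_cases[of s] by (elim disjE) simp_all
  qed
  then show "s \<in> {0}"
    by blast
qed (auto simp: mem_restricted_gaps_iff mod7_fringe_def)

text \<open>Modulo 7, \<open>{0, 1, 2, 4}\<close> is the complement of \<open>6 - {0, 1, 3}\<close>,
  so class 6 is not reached below \<open>7 * k\<close>.\<close>

lemma sum_gaps_mod7:
  "sum_gaps (mod7_fringe {0, 1, 3} k) (mod7_fringe {0, 1, 2, 4} k)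
    = (\<lambda>i. 7 * i + 6) ` {0..<k}" (is "sum_gaps ?L ?R = _")
proof (intro set_eqI iffI)
  fix s assume "s \<in> sum_gaps ?L ?R"
  then have s: "0 \<le> s" and gap: "\<And>a. a \<in> ?L \<Longrightarrow> s - a \<notin> ?R"
    by (auto simp: mem_sum_gaps_iff)
  \<comment> \<open>The splittings tried are \<open>0 + s\<close>, \<open>1 + (s - 1)\<close> and
    \<open>s + 0\<close>; the second settles class 5, the third class 3.\<close>
  have "0 \<in> ?L" "1 \<in> ?L" "0 \<in> ?R"
    by (auto simp: mod7_fringe_def)
  with gap have * : "s \<notin> ?R" "s - 1 \<notin> ?R" "s \<notin> ?L"
    by fastforce+
  have out: "x mod 7 \<notin> {0, 1, 2, 4} \<and> x < 7 * k" if "0 \<le> x" "x \<notin> ?R" for x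
    using that by (auto simp: mod7_fringe_def)
  from out[OF s *(1)] have r: "s mod 7 \<notin> {0, 1, 2, 4}" "s < 7 * k"
    by simp_all
  then have "s \<noteq> 0"
    by auto
  then have "(s - 1) mod 7 \<notin> {0, 1, 2, 4}"
    using *(2) out[of "s - 1"] s by linarith
  then have "s mod 7 \<noteq> 5"
    using mod7_diff[of s 1] by auto
  moreover have "s mod 7 \<noteq> 3"
    using s r(2) *(3) by (auto simp: mod7_fringe_def)
  ultimately have "s < 7 * k \<and> s mod 7 = 6"
    using r mod7_cases[of s] by simp
  then show "s \<in> (\<lambda>i. 7 * i + 6) ` {0..<k}"
    using s mem_arithmetic_progression_iff[of 6 s k] by auto
next
  fix s assume "s \<in> (\<lambda>i. 7 * i + 6) ` {0..<k}"
  then have s: "0 \<le> s" "s < 7 * k" "s mod 7 = 6"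
    using mem_arithmetic_progression_iff[of 6 s k] by auto
  have "s - a \<notin> ?R" if "a \<in> ?L" for a
  proof
    assume "s - a \<in> ?R"
    with that s(2) have "a mod 7 \<in> {0, 1, 3}" "(s - a) mod 7 \<in> {0, 1, 2, 4}"
      by (auto simp: mod7_fringe_def)
    then show False
      using s(3) mod7_diff[of s a] by auto
  qed
  then show "s \<in> sum_gaps ?L ?R"
    using s by (auto simp: mem_sum_gaps_iff)
qed

lemma Delta_small:
  assumes "(x::int) \<le> 3"
  shows "\<exists>A. finite A \<and> A \<noteq> {} \<and> Delta A = x"
proof -
  \<comment> \<open>The gap counts \<open>3 + k\<close>, 1 and \<open>k\<close> give
    \<open>(3 + k) + 1 - 2 * k = 4 - k\<close>.\<close>
  define k where "k = 4 - x"
  have k: "1 \<le> k"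
    using assms k_def by simp
  let ?L = "mod7_fringe {0, 1, 3} k" and ?R = "mod7_fringe {0, 1, 2, 4} k"
  have "fringes ?L ?R (7 * k)"
    using k by unfold_locales (auto simp: mod7_fringe_def)
  moreover have "card ({0, 2, 6} \<union> (\<lambda>i. 7 * i + 5) ` {0..<k}) = 3 + nat k"
  proof -
    have "{0, 2, 6} \<inter> (\<lambda>i. 7 * i + 5) ` {0..<k} = {}"
      using mem_arithmetic_progression_iff[of 5 _ k] by auto
    then show ?thesis
      by (simp add: card_Un_disjoint card_arithmetic_progression)
  qed
  ultimately show ?thesis
    using fringes.Delta_attained[of ?L ?R "7 * k"] k k_def
    by (simp add: restricted_gaps_mod7_013 restricted_gaps_mod7_0124 sum_gaps_mod7
        card_arithmetic_progression)
qed

theorem theorem2: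
  shows "\<forall>x::int. \<exists>A::int set. finite A \<and> A \<noteq> {} \<and> Delta A = - x"
proof
  fix x :: int
  show "\<exists>A::int set. finite A \<and> A \<noteq> {} \<and> Delta A = - x"
    using Delta_large[of "- x"] Delta_small[of "- x"] by (cases "2 \<le> - x") auto
qed

end
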